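(* Let $G$ be a simple graph with vertex set $V=\{v_1,\ldots,v_n\}$, let $A$ be a parameter list for $G$, and let $\mathcal{O}$ be an acyclic partial orientation of $G$. Then there exists an $A$-admissible partial orientation $\mathcal{O}'$ of $G$ with $\mathrm{indeg}(\mathcal{O}')=\mathrm{indeg}(\mathcal{O})$.
   Context: A parameter list $A$ assigns to each edge $\{v_i,v_j\}$ of $G$ real numbers $a_{ij},a_{ji}$ such that some $x\in\mathbb{R}^n$ satisfies $x_i-x_j<a_{ij}$ for all ordered pairs $(i,j)$ with $\{v_i,v_j\}$ an edge. A step is an ordered pair $(u,v)$ with $\{u,v\}$ an edge; a partial orientation $\mathcal{O}$ is a set of steps containing at most one of $(u,v),(v,u)$ per edge; edges with neither are blank. $\mathcal{O}$ is acyclic if it contains no directed cycle of steps. $\mathrm{indeg}(\mathcal{O})=\sum_i \mathrm{indeg}_{\mathcal{O}}(v_i)v_i$ where $\mathrm{indeg}_{\mathcal{O}}(u)$ is the number of steps $(w,u)\in\mathcal{O}$. A step $(u,v)$ is compatible with $\mathcal{O}$ if $(v,u)\notin\mathcal{O}$; a potential cycle for $\mathcal{O}$ is a set $\{(u_1,u_2),\ldots,(u_k,u_1)\}$ of compatible steps; the score of a compatible step $(v_i,v_j)$ is $a_{ij}$ if the edge is blank and $-a_{ji}$ if $(v_i,v_j)\in\mathcal{O}$; a potential cycle's score is the sum of its steps' scores. $\mathcal{O}$ is $A$-admissible if every potential cycle for $\mathcal{O}$ has positive score. *)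

theory Defs
  imports Complex_Main "HOL-Library.Poly_Mapping"
begin

definition simple_graph :: "'v set \<Rightarrow> 'v set set \<Rightarrow> bool" where
  "simple_graph V E \<longleftrightarrow> finite V \<and> (\<forall>e\<in>E. e \<subseteq> V \<and> card e = 2)"

definition steps :: "'v set set \<Rightarrow> ('v \<times> 'v) set" where
  "steps E = {(u, v). {u, v} \<in> E}"

(* Vertices serve as their own indices: the number a_ij is a v_i v_j, and a point of R^n is a
   function x on the vertices. Values of a off the edges and of x off V are irrelevant. *)
definition parameter_list :: "'v set set \<Rightarrow> ('v \<Rightarrow> 'v \<Rightarrow> real) \<Rightarrow> bool" where
  "parameter_list E a \<longleftrightarrow> (\<exists>x :: 'v \<Rightarrow> real. \<forall>(u, v)\<in>steps E. x u - x v < a u v)"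

definition partial_orientation :: "'v set set \<Rightarrow> ('v \<times> 'v) set \<Rightarrow> bool" where
  "partial_orientation E \<O> \<longleftrightarrow> \<O> \<subseteq> steps E \<and> (\<forall>u v. \<not> ((u, v) \<in> \<O> \<and> (v, u) \<in> \<O>))"

definition indeg_at :: "('v \<times> 'v) set \<Rightarrow> 'v \<Rightarrow> nat" where
  "indeg_at \<O> u = card {w. (w, u) \<in> \<O>}"

(* Formal integer sums of vertices are finitely supported functions from vertices to int. *)
definition indeg :: "'v set \<Rightarrow> ('v \<times> 'v) set \<Rightarrow> 'v \<Rightarrow>\<^sub>0 int" where
  "indeg V \<O> = (\<Sum>u\<in>V. Poly_Mapping.single u (int (indeg_at \<O> u)))"

definition compatible_steps :: "'v set set \<Rightarrow> ('v \<times> 'v) set \<Rightarrow> ('v \<times> 'v) set" where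
  "compatible_steps E \<O> = {(u, v). (u, v) \<in> steps E \<and> (v, u) \<notin> \<O>}"

(* Meaningful for compatible steps only; such a step outside the orientation lies on a blank edge. *)
definition score :: "('v \<Rightarrow> 'v \<Rightarrow> real) \<Rightarrow> ('v \<times> 'v) set \<Rightarrow> 'v \<times> 'v \<Rightarrow> real" where
  "score a \<O> = (\<lambda>(u, v). if (u, v) \<in> \<O> then - a v u else a u v)"

(* For us = [u1, ..., uk] the set is {(u1,u2), ..., (uk,u1)}. The vertices of a cycle are distinct,
   so no step repeats and summing over the set counts every step once. Lists of length 1 contribute
   nothing, since (u1,u1) is not a step; length 2 means both directions of a blank edge. *)
definition potential_cycle ::
    "'v set set \<Rightarrow> ('v \<times> 'v) set \<Rightarrow> ('v \<times> 'v) set \<Rightarrow> bool" where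
  "potential_cycle E \<O> C \<longleftrightarrow>
     (\<exists>us. us \<noteq> [] \<and> distinct us \<and> C = set (zip us (rotate1 us)) \<and> C \<subseteq> compatible_steps E \<O>)"

definition admissible ::
    "'v set set \<Rightarrow> ('v \<Rightarrow> 'v \<Rightarrow> real) \<Rightarrow> ('v \<times> 'v) set \<Rightarrow> bool" where
  "admissible E a \<O> \<longleftrightarrow> (\<forall>C. potential_cycle E \<O> C \<longrightarrow> (\<Sum>s\<in>C. score a \<O> s) > 0)"

end

(* An orientation is admissible as soon as it is read off a generic point x, with (u, v) oriented
   iff x v - x u > a v u.  Subtracting the point given by the parameter list makes all parameters
   positive.  Then x is found by Dhar's burning process in continuous time: a vertex u that burns
   at time x u sends a signal reaching its neighbour w at time x u + a w u, and w burns just after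
   its d(w)-th signal, where d is the prescribed indegree.  Acyclicity guarantees that everything
   burns, and tiny delays keep the arrival times distinct. *)
theory Submission
  imports Defs
begin

section \<open>The burning process in continuous time\<close>

lemma finite_gap_above:
  fixes M :: "'a :: {linorder, dense_order, no_top}"
  assumes "finite F"
  shows "\<exists>z>M. \<forall>f\<in>F. M < f \<longrightarrow> z < f"
  using assms
proof (induction F)
  case empty
  then show ?case using gt_ex by auto
next
  case (insert f F)
  then obtain z where z: "z > M" "\<forall>g\<in>F. M < g \<longrightarrow> z < g" by blast
  show ?case
  proof (cases "M < f")
    case True
    then obtain y where "M < y" "y < min z f" using dense[of M "min z f"] z(1) by auto
    with z show ?thesis by (intro exI[of _ y]) auto
  next
    case False
    with z show ?thesis by auto
  qed
qed

definition arrivals_by ::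
    "('v \<times> 'v) set \<Rightarrow> ('v \<Rightarrow> 'v \<Rightarrow> real) \<Rightarrow> 'v set \<Rightarrow> ('v \<Rightarrow> real) \<Rightarrow> real \<Rightarrow> 'v \<Rightarrow> 'v set" where
  "arrivals_by R b S x t w = {u\<in>S. (u, w) \<in> R \<and> x u + b w u \<le> t}"

(* The state of the burning process at time M, when S is the set of burnt vertices. *)
definition burning_state ::
    "'v set \<Rightarrow> ('v \<times> 'v) set \<Rightarrow> ('v \<Rightarrow> 'v \<Rightarrow> real) \<Rightarrow> ('v \<Rightarrow> nat) \<Rightarrow> 'v set \<Rightarrow> ('v \<Rightarrow> real) \<Rightarrow> real \<Rightarrow> bool"
  where
  "burning_state V R b d S x M \<longleftrightarrow>
     S \<subseteq> V \<and>
     (\<forall>v\<in>S. x v \<le> M) \<and>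
     (\<forall>v\<in>S. card (arrivals_by R b S x (x v) v) = d v) \<and>
     (\<forall>u\<in>S. \<forall>v\<in>S. (u, v) \<in> R \<longrightarrow> x u + b v u \<noteq> x v) \<and>
     (\<forall>w. \<forall>u\<in>S. \<forall>u'\<in>S. (u, w) \<in> R \<longrightarrow> (u', w) \<in> R \<longrightarrow> x u + b w u = x u' + b w u' \<longrightarrow> u = u') \<and>
     (\<forall>w\<in>V - S. card (arrivals_by R b S x M w) \<le> d w)"

lemma burning_stateD:
  assumes "burning_state V R b d S x M"
  shows "S \<subseteq> V"
    and "\<And>v. v \<in> S \<Longrightarrow> x v \<le> M"
    and "\<And>v. v \<in> S \<Longrightarrow> card (arrivals_by R b S x (x v) v) = d v"
    and "\<And>u v. u \<in> S \<Longrightarrow> v \<in> S \<Longrightarrow> (u, v) \<in> R \<Longrightarrow> x u + b v u \<noteq> x v"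
    and "\<And>w u u'. u \<in> S \<Longrightarrow> u' \<in> S \<Longrightarrow> (u, w) \<in> R \<Longrightarrow> (u', w) \<in> R \<Longrightarrow>
           x u + b w u = x u' + b w u' \<Longrightarrow> u = u'"
    and "\<And>w. w \<in> V - S \<Longrightarrow> card (arrivals_by R b S x M w) \<le> d w"
  using assms unfolding burning_state_def by blast+

text \<open>The clock runs, burning nothing, to the first moment at which some unburnt vertex has
  its \<open>d w\<close> signals. Signals from \<open>S\<close> reach a given vertex at distinct
  times, so its count grows one by one and no count overshoots \<open>d\<close>.\<close>

lemma burning_state_advance:
  assumes fin: "finite V"
    and st: "burning_state V R b d S x M"
    and ready: "\<exists>w\<in>V - S. d w \<le> card {u\<in>S. (u, w) \<in> R}"
  shows "\<exists>M'. burning_state V R b d S x M' \<and>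
           (\<exists>w\<in>V - S. card (arrivals_by R b S x M' w) = d w)"
proof -
  note SV = burning_stateD(1)[OF st]
  have finS: "finite S" using SV fin finite_subset by blast
  \<comment> \<open>Counts change only at arrival times, so the first such moment can be sought in
    this finite set.\<close>
  define T where "T = insert M ((\<lambda>(w, u). x u + b w u) ` (V \<times> S))"
  have finT: "finite T" using fin finS by (auto simp: T_def)
  define Q where "Q = {t\<in>T. M \<le> t \<and> (\<exists>w\<in>V - S. d w \<le> card (arrivals_by R b S x t w))}"
  \<comment> \<open>By \<open>Max T\<close> every signal from \<open>S\<close> has arrived, so the
    vertex from \<open>ready\<close> qualifies.\<close>
  have "Max T \<in> Q"
  proof -
    have M: "M \<le> Max T" using finT by (simp add: T_def)
    obtain w where w: "w \<in> V - S" "d w \<le> card {u\<in>S. (u, w) \<in> R}" using ready by blast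
    have "x u + b w u \<le> Max T" if "u \<in> S" for u
      using w that finT by (intro Max_ge) (auto simp: T_def)
    then have "arrivals_by R b S x (Max T) w = {u\<in>S. (u, w) \<in> R}"
      by (auto simp: arrivals_by_def)
    moreover have "Max T \<in> T" using finT by (intro Max_in) (auto simp: T_def)
    moreover have "\<exists>w\<in>V - S. d w \<le> card (arrivals_by R b S x (Max T) w)"
      using w calculation(1) by (intro bexI[of _ w]) simp_all
    ultimately show ?thesis using M by (simp add: Q_def)
  qed
  moreover have finQ: "finite Q" using finT by (simp add: Q_def)
  ultimately have tQ: "Min Q \<in> Q" using Min_in by blast
  define t where "t = Min Q"
  have tM: "M \<le> t" using tQ by (simp add: Q_def t_def)
  have bound: "card (arrivals_by R b S x t w) \<le> d w" if w: "w \<in> V - S" for w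
  proof (cases "t = M")
    case True
    then show ?thesis using burning_stateD(6)[OF st w] by simp
  next
    case False
    define P where "P = {s\<in>T. s < t}"
    have MP: "M \<in> P" using False tM by (auto simp: P_def T_def)
    have finP: "finite P" using finT by (simp add: P_def)
    \<comment> \<open>The last event before \<open>t\<close>. As \<open>t\<close> is minimal, the
      count at \<open>p\<close> is still below \<open>d w\<close>; between \<open>p\<close> and
      \<open>t\<close> nothing arrives, and at \<open>t\<close> itself at most one signal does (the
      set \<open>D\<close>).\<close>
    define p where "p = Max P"
    have pP: "p \<in> P" using MP finP Max_in unfolding p_def by blast
    have Mp: "M \<le> p" using MP finP by (simp add: p_def)
    have "p \<notin> Q"
      using pP Min_le[OF finQ, of p] by (auto simp: P_def t_def)
    then have lt: "card (arrivals_by R b S x p w) < d w"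
      using pP Mp w unfolding Q_def P_def by (force simp: not_le)
    define D where "D = {u\<in>S. (u, w) \<in> R \<and> x u + b w u = t}"
    have "u = u'" if "u \<in> D" "u' \<in> D" for u u'
      using that burning_stateD(5)[OF st, of u u' w] by (simp add: D_def)
    then have cD: "card D \<le> 1" using finS by (simp add: card_le_Suc0_iff_eq D_def)
    have "arrivals_by R b S x t w \<subseteq> arrivals_by R b S x p w \<union> D"
    proof
      fix u assume u: "u \<in> arrivals_by R b S x t w"
      have "x u + b w u \<le> p" if "x u + b w u < t"
        using that u w finP unfolding p_def
        by (intro Max_ge) (auto simp: P_def T_def arrivals_by_def)
      then show "u \<in> arrivals_by R b S x p w \<union> D"
        using u by (auto simp: D_def arrivals_by_def)
    qed
    moreover have "finite (arrivals_by R b S x p w \<union> D)"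
      using finS by (simp add: arrivals_by_def D_def)
    ultimately have "card (arrivals_by R b S x t w) \<le> card (arrivals_by R b S x p w \<union> D)"
      by (intro card_mono)
    also have "\<dots> \<le> card (arrivals_by R b S x p w) + card D" by (rule card_Un_le)
    finally show ?thesis using lt cD by linarith
  qed
  have "burning_state V R b d S x t"
    using st bound order_trans[OF _ tM] by (simp add: burning_state_def)
  moreover obtain w where "w \<in> V - S" "d w \<le> card (arrivals_by R b S x t w)"
    using tQ by (auto simp: Q_def t_def)
  ultimately show ?thesis using bound[of w] by (intro exI[of _ t] conjI bexI[of _ w]) auto
qed

text \<open>If \<open>z\<close> is close enough above \<open>M\<close>, no signal from
  \<open>S\<close> arrives after \<open>M\<close> and up to \<open>z\<close>, and the signals of
  \<open>w\<close> arrive after \<open>z\<close> because \<open>b\<close> is positive on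
  \<open>R\<close>. So burning \<open>w\<close> at \<open>z\<close> leaves all counts as they were
  at \<open>M\<close>.\<close>

lemma burning_state_burn:
  assumes fin: "finite V"
    and pos: "\<And>u v. (u, v) \<in> R \<Longrightarrow> b v u > 0"
    and R: "R \<subseteq> V \<times> V"
    and st: "burning_state V R b d S x M"
    and w: "w \<in> V - S" "card (arrivals_by R b S x M w) = d w"
  shows "\<exists>z. burning_state V R b d (insert w S) (x(w := z)) z"
proof -
  note SV = burning_stateD(1)[OF st] and xS = burning_stateD(2)[OF st]
  have finS: "finite S" using SV fin finite_subset by blast
  \<comment> \<open>The first set holds the arrival times, since \<open>z\<close> must precede the
    pending ones. The second holds the burning times of \<open>w\<close> at which its signal to
    \<open>v\<close> would tie with that of \<open>u\<close>.\<close>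
  define F where "F = (\<lambda>(v, u). x u + b v u) ` (V \<times> S) \<union> (\<lambda>(v, u). x u + b v u - b v w) ` (V \<times> S)"
  have "finite F" using fin finS by (auto simp: F_def)
  then obtain z where z: "z > M" "\<forall>f\<in>F. M < f \<longrightarrow> z < f" using finite_gap_above by blast
  have arr: "M < x u + b v u \<Longrightarrow> z < x u + b v u" if "v \<in> V" "u \<in> S" for u v
    using z(2) that by (force simp: F_def)
  have tie: "x u + b v u \<noteq> z + b v w" if "v \<in> V" "u \<in> S" for u v
  proof -
    have "x u + b v u - b v w \<in> F" using that by (force simp: F_def)
    then show ?thesis using z by force
  qed
  let ?x = "x(w := z)"
  have upto_z: "arrivals_by R b (insert w S) ?x z v = arrivals_by R b S x M v" if "v \<in> V" for v
  proof -
    have "x u + b v u \<le> z \<longleftrightarrow> x u + b v u \<le> M" if "u \<in> S" for u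
      using arr[OF \<open>v \<in> V\<close> that] z(1) by linarith
    then show ?thesis
      using w pos by (auto simp: arrivals_by_def dest: pos)
  qed
  \<comment> \<open>Burning times recorded so far are at most \<open>M\<close>, so their counts do
    not see the signals of \<open>w\<close>.\<close>
  have before: "arrivals_by R b (insert w S) ?x t v = arrivals_by R b S x t v" if "t \<le> M" for t v
    using that w z(1) pos[of w v] by (auto simp: arrivals_by_def)
  show ?thesis
  proof (intro exI[of _ z], unfold burning_state_def, intro conjI)
    show "insert w S \<subseteq> V" using w SV by auto
    show "\<forall>v\<in>insert w S. ?x v \<le> z" using xS z(1) by force
    show "\<forall>v\<in>insert w S. card (arrivals_by R b (insert w S) ?x (?x v) v) = d v"
    proof
      fix v assume v: "v \<in> insert w S"
      show "card (arrivals_by R b (insert w S) ?x (?x v) v) = d v"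
      proof (cases "v = w")
        case True
        then show ?thesis using upto_z w by simp
      next
        case False
        with v have "v \<in> S" by simp
        then show ?thesis using False before[OF xS] burning_stateD(3)[OF st] by simp
      qed
    qed
    show "\<forall>u\<in>insert w S. \<forall>v\<in>insert w S. (u, v) \<in> R \<longrightarrow> ?x u + b v u \<noteq> ?x v"
    proof (intro ballI impI)
      fix u v assume uv: "u \<in> insert w S" "v \<in> insert w S" "(u, v) \<in> R"
      have st3: "x u + b v u \<noteq> x v" if "u \<in> S" "v \<in> S"
        using burning_stateD(4)[OF st that uv(3)] .
      \<comment> \<open>Signals of \<open>w\<close> arrive after every recorded burning time;
        arrivals at \<open>w\<close> from \<open>S\<close> are either at most \<open>M\<close>,
        hence before \<open>z\<close>, or after \<open>z\<close> by \<open>arr\<close>.\<close>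
      show "?x u + b v u \<noteq> ?x v"
        using uv pos[OF uv(3)] st3 xS[of v] z(1) w arr[of w u] by (cases "u = w"; cases "v = w") auto
    qed
    show "\<forall>v. \<forall>u\<in>insert w S. \<forall>u'\<in>insert w S. (u, v) \<in> R \<longrightarrow> (u', v) \<in> R \<longrightarrow>
            ?x u + b v u = ?x u' + b v u' \<longrightarrow> u = u'"
    proof (intro ballI allI impI)
      fix v u u' assume u: "u \<in> insert w S" "u' \<in> insert w S" "(u, v) \<in> R" "(u', v) \<in> R"
        "?x u + b v u = ?x u' + b v u'"
      have v: "v \<in> V" using u R by auto
      have "u = u'" if "u \<in> S" "u' \<in> S" "x u + b v u = x u' + b v u'"
        using burning_stateD(5)[OF st that(1,2) u(3,4) that(3)] .
      then show "u = u'"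
        using u tie[OF v, of u] tie[OF v, of u'] w by (cases "u = w"; cases "u' = w") auto
    qed
    show "\<forall>v\<in>V - insert w S. card (arrivals_by R b (insert w S) ?x z v) \<le> d v"
      using upto_z burning_stateD(6)[OF st] by simp
  qed
qed

text \<open>\<open>parking\<close>, applied to the unburnt vertices, keeps the fire going: some
  \<open>w\<close> among them has enough burnt neighbours to receive \<open>d w\<close> signals. For
  \<open>U = V\<close> it gives a \<open>w\<close> with \<open>d w = 0\<close>, where the fire
  starts.\<close>

lemma parking_function_realizable:
  fixes b :: "'v \<Rightarrow> 'v \<Rightarrow> real"
  assumes fin: "finite V"
    and R: "R \<subseteq> V \<times> V"
    and pos: "\<And>u v. (u, v) \<in> R \<Longrightarrow> b v u > 0"
    and parking: "\<And>U. U \<subseteq> V \<Longrightarrow> U \<noteq> {} \<Longrightarrow> \<exists>w\<in>U. d w \<le> card {u\<in>V - U. (u, w) \<in> R}"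
  shows "\<exists>x. (\<forall>v\<in>V. card {u. (u, v) \<in> R \<and> x u + b v u < x v} = d v) \<and>
             (\<forall>(u, v)\<in>R. x u + b v u \<noteq> x v)"
proof -
  have "\<exists>S x M. burning_state V R b d S x M \<and> card S = k" if "k \<le> card V" for k
    using that
  proof (induction k)
    case 0
    have "burning_state V R b d {} (\<lambda>_. 0) 0" by (simp add: burning_state_def arrivals_by_def)
    then show ?case by (metis card.empty)
  next
    case (Suc k)
    then obtain S x M where st: "burning_state V R b d S x M" and card: "card S = k" by auto
    note SV = burning_stateD(1)[OF st]
    have "V - S \<noteq> {}" using SV card Suc.prems by (metis Diff_eq_empty_iff Suc_n_not_le_n subset_antisym)
    then have "\<exists>w\<in>V - S. d w \<le> card {u\<in>S. (u, w) \<in> R}"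
      using parking[of "V - S"] SV by (simp add: double_diff)
    then obtain M' w where "burning_state V R b d S x M'" and w: "w \<in> V - S"
      and "card (arrivals_by R b S x M' w) = d w"
      using burning_state_advance[OF fin st] by blast
    then obtain z where "burning_state V R b d (insert w S) (x(w := z)) z"
      using burning_state_burn[where b = b, OF fin pos R] by blast
    moreover have "card (insert w S) = Suc k" using w card fin SV finite_subset[of S V] by simp
    ultimately show ?case by blast
  qed
  then obtain S x M where st: "burning_state V R b d S x M" and "card S = card V" by blast
  then have "S = V" using fin burning_stateD(1)[OF st] by (simp add: card_subset_eq)
  with st have st: "burning_state V R b d V x M" by simp
  have neq: "x u + b v u \<noteq> x v" if "(u, v) \<in> R" for u v
    using that R burning_stateD(4)[OF st] by blast
  \<comment> \<open>The process counts arrivals up to and including \<open>x v\<close>;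
    \<open>neq\<close> rules out equality.\<close>
  have "{u. (u, v) \<in> R \<and> x u + b v u < x v} = arrivals_by R b V x (x v) v" for v
    using R neq by (force simp: arrivals_by_def less_le)
  then show ?thesis using burning_stateD(3)[OF st] neq by (intro exI[of _ x]) auto
qed

text \<open>Acyclicity provides a source \<open>w\<close> of \<O> within \<open>U\<close>; all steps
  of \<O> into it start outside \<open>U\<close>.\<close>

lemma acyclic_indegree_parking:
  assumes fin: "finite V" and R: "R \<subseteq> V \<times> V" and OR: "\<O> \<subseteq> R" and ac: "acyclic \<O>"
    and U: "U \<subseteq> V" "U \<noteq> {}"
  shows "\<exists>w\<in>U. indeg_at \<O> w \<le> card {u\<in>V - U. (u, w) \<in> R}"
proof -
  have "finite \<O>" using fin R OR by (meson finite_SigmaI finite_subset)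
  then have "wf \<O>" using ac finite_acyclic_wf by blast
  then obtain w where w: "w \<in> U" "\<And>u. (u, w) \<in> \<O> \<Longrightarrow> u \<notin> U"
    using U(2) by (metis all_not_in_conv wfE_min)
  then have "{u. (u, w) \<in> \<O>} \<subseteq> {u\<in>V - U. (u, w) \<in> R}" using OR R by auto
  then have "indeg_at \<O> w \<le> card {u\<in>V - U. (u, w) \<in> R}"
    unfolding indeg_at_def using fin by (intro card_mono) auto
  with w show ?thesis by blast
qed

section \<open>Admissibility from potentials\<close>

lemma sum_zip_rotate1_diff:
  fixes x :: "'v \<Rightarrow> real"
  assumes "distinct us"
  shows "(\<Sum>(u, v)\<in>set (zip us (rotate1 us)). x u - x v) = 0"
proof -
  have "distinct (zip us (rotate1 us))" using assms by (simp add: distinct_zipI1)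
  then have "(\<Sum>(u, v)\<in>set (zip us (rotate1 us)). x u - x v)
      = (\<Sum>(u, v)\<leftarrow>zip us (rotate1 us). x u - x v)"
    by (simp add: sum_list_distinct_conv_sum_set)
  also have "\<dots> = sum_list (map x us) - sum_list (map x (rotate1 us))"
  proof -
    have "(\<Sum>(u, v)\<leftarrow>zip us vs. x u - x v) = sum_list (map x us) - sum_list (map x vs)"
      if "length us = length vs" for us vs
      using that by (induction us vs rule: list_induct2) auto
    then show ?thesis by simp
  qed
  also have "sum_list (map x (rotate1 us)) = sum_list (map x us)"
    by (cases us) simp_all
  finally show ?thesis by simp
qed

text \<open>\<open>x\<close> acts as a potential: its differences telescope to zero around a cycle,
  so scores strictly above them have a positive sum.\<close>

lemma admissibleI:
  assumes "\<And>u v. (u, v) \<in> compatible_steps E \<O> \<Longrightarrow> x u - x v < score a \<O> (u, v)"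
  shows "admissible E a \<O>"
  unfolding admissible_def
proof (intro allI impI)
  fix C assume "potential_cycle E \<O> C"
  then obtain us where us: "us \<noteq> []" "distinct us" "C = set (zip us (rotate1 us))"
    and C: "C \<subseteq> compatible_steps E \<O>"
    by (auto simp: potential_cycle_def)
  have "C \<noteq> {}" using us(1,3) by (cases us) (auto simp: neq_Nil_conv)
  moreover have "finite C" using us by simp
  ultimately have "(\<Sum>(u, v)\<in>C. x u - x v) < (\<Sum>s\<in>C. score a \<O> s)"
    using C assms by (intro sum_strict_mono) auto
  then show "(\<Sum>s\<in>C. score a \<O> s) > 0" using sum_zip_rotate1_diff[OF us(2)] us(3) by simp
qed

theorem mainTheorem5:
  fixes V :: "'v set" and E :: "'v set set"
    and a :: "'v \<Rightarrow> 'v \<Rightarrow> real" and \<O> :: "('v \<times> 'v) set"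
  assumes "simple_graph V E"
    and "parameter_list E a"
    and "partial_orientation E \<O>"
    and "acyclic \<O>"
  shows "\<exists>\<O>'. partial_orientation E \<O>' \<and> admissible E a \<O>' \<and> indeg V \<O>' = indeg V \<O>"
proof -
  have fin: "finite V" and R: "steps E \<subseteq> V \<times> V"
    using assms(1) by (auto simp: simple_graph_def steps_def)
  have sym: "(v, u) \<in> steps E" if "(u, v) \<in> steps E" for u v
    using that by (simp add: steps_def insert_commute)
  have OR: "\<O> \<subseteq> steps E" using assms(3) by (simp add: partial_orientation_def)
  obtain y where y: "\<And>u v. (u, v) \<in> steps E \<Longrightarrow> y u - y v < a u v"
    using assms(2) by (auto simp: parameter_list_def)
  \<comment> \<open>Translation by the feasible point \<open>y\<close> makes the parameters
    positive, so that \<open>b v u\<close> can serve as the travel time from \<open>u\<close> to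
    \<open>v\<close>.\<close>
  define b where "b v u = a v u - y v + y u" for v u
  have pos: "b v u > 0" if "(u, v) \<in> steps E" for u v
    using y[OF sym[OF that]] by (simp add: b_def)
  obtain x where x: "\<forall>v\<in>V. card {u. (u, v) \<in> steps E \<and> x u + b v u < x v} = indeg_at \<O> v"
    and "\<forall>(u, v)\<in>steps E. x u + b v u \<noteq> x v"
    using parking_function_realizable[where b = b and d = "indeg_at \<O>",
        OF fin R pos acyclic_indegree_parking[OF fin R OR assms(4)]] by blast
  then have neq: "x u + b v u \<noteq> x v" if "(u, v) \<in> steps E" for u v using that by blast
  \<comment> \<open>A step points into \<open>v\<close> when the signal along it arrives before
    \<open>v\<close> burns; by \<open>x\<close> there are \<open>indeg_at \<O> v\<close> of
    these.\<close>
  define P where "P = {(u, v) \<in> steps E. x u + b v u < x v}"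
  have "partial_orientation E P"
    unfolding partial_orientation_def
  proof (intro conjI allI notI)
    show "P \<subseteq> steps E" by (auto simp: P_def)
    \<comment> \<open>Opposite steps would force \<open>b v u + b u v < 0\<close>.\<close>
    show False if "(u, v) \<in> P \<and> (v, u) \<in> P" for u v
      using that pos[of u v] pos[of v u] by (simp add: P_def)
  qed
  moreover have "admissible E a P"
  \<comment> \<open>Adding \<open>y\<close> undoes the translation from \<open>a\<close> to
    \<open>b\<close>.\<close>
  proof (rule admissibleI[where x = "\<lambda>v. x v + y v"])
    fix u v assume uv: "(u, v) \<in> compatible_steps E P"
    then have "(v, u) \<in> steps E" using sym by (simp add: compatible_steps_def)
    \<comment> \<open>For a step of \<open>P\<close> this is the defining inequality. On a blank
      edge, \<open>(v, u)\<close> not being in \<open>P\<close> gives only a weak inequality, which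
      \<open>neq\<close> makes strict.\<close>
    with uv neq[of v u] show "x u + y u - (x v + y v) < score a P (u, v)"
      by (auto simp: compatible_steps_def score_def P_def b_def)
  qed
  moreover have "indeg V P = indeg V \<O>"
    unfolding indeg_def using x by (intro sum.cong) (auto simp: indeg_at_def P_def)
  ultimately show ?thesis by blast
qed

end
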